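(* Let $T\subset\mathbb{R}^d$ be a simplicial boundary element of $\Omega_h$, let $\{\psi_k\}_{k=1}^D$ be a basis of $\mathbb{P}_p$, let $\boldsymbol{\varphi}=[\psi_1,\ldots,\psi_D]^T$, and let $u_h(\mathbf{x})=\boldsymbol{\varphi}^T(\mathbf{x})\hat{\mathbf{u}}$ with $\hat{\mathbf{u}}\in\mathbb{R}^D$ be the internal polynomial of $T$. Let $\tilde{\mathbf{x}}\in\partial\Omega_h$ be a point of the computational boundary, let $\bar{\mathbf{x}}=\mathcal{M}(\tilde{\mathbf{x}})\in\partial\Omega$ be the corresponding point of the physical boundary, and let $u_{\mathcal{D}}(\bar{\mathbf{x}})\in\mathbb{R}$ be the Dirichlet datum at $\bar{\mathbf{x}}$. Let $\hat{\mathbf{v}}\in\mathbb{R}^D$ be the coefficients given by the single-constraint ROD-E method, i.e. $(\hat{\mathbf{v}},\lambda)\in\mathbb{R}^D\times\mathbb{R}$ solves $$\begin{bmatrix}\mathbf{I} & \boldsymbol{\varphi}(\bar{\mathbf{x}}) \\ \boldsymbol{\varphi}^T(\bar{\mathbf{x}}) & 0 \end{bmatrix}\begin{bmatrix}\hat{\mathbf{v}} \\ \lambda \end{bmatrix} = \begin{bmatrix}\hat{\mathbf{u}} \\ u_{\mathcal{D}}(\bar{\mathbf{x}}) \end{bmatrix},$$ and let $v_h(\mathbf{x})=\boldsymbol{\varphi}^T(\mathbf{x})\hat{\mathbf{v}}$. Then the boundary value $v_h(\tilde{\mathbf{x}})$ imposed by the method is given by the polynomial correction $$v_h(\tilde{\mathbf{x}})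 = [\boldsymbol{\varphi}(\tilde{\mathbf{x}}) - \alpha\, \boldsymbol{\varphi}(\bar{\mathbf{x}})]^T \hat{\mathbf{u}} + \alpha\, u_{\mathcal{D}}(\bar{\mathbf{x}}),\qquad \alpha = \frac{\boldsymbol{\varphi}^T(\tilde{\mathbf{x}}) \boldsymbol{\varphi}(\bar{\mathbf{x}})}{\boldsymbol{\varphi}^T(\bar{\mathbf{x}}) \boldsymbol{\varphi}(\bar{\mathbf{x}})} = \frac{\boldsymbol{\varphi}^T(\tilde{\mathbf{x}}) \boldsymbol{\varphi}(\bar{\mathbf{x}})}{\|\boldsymbol{\varphi}(\bar{\mathbf{x}})\|_2^2}.$$
   Context: $\mathbb{P}_p$ is the space of real polynomials in $d$ variables of total degree at most $p$, and $D=\prod_{\ell=1}^d (p+\ell)/\ell$ is its dimension. $\Omega\subset\mathbb{R}^d$ is the physical domain with (curved) boundary $\partial\Omega$; $\Omega_h$ is its approximation by a union of non-overlapping simplices, with boundary $\partial\Omega_h$; $\mathcal{M}$ is a map associating to each $\tilde{\mathbf{x}}\in\partial\Omega_h$ a unique point $\bar{\mathbf{x}}=\mathcal{M}(\tilde{\mathbf{x}})\in\partial\Omega$. Polynomials and basis functions are evaluated at any point of $\mathbb{R}^d$ (in particular at $\bar{\mathbf{x}}$, which need not lie in $T$). The single-constraint ROD-E (Reconstruction for Off-site Data, Euclidean norm) method builds, for each pair $(\tilde{\mathbf{x}},\bar{\mathbf{x}})$, a modified polynomial $v_h=\boldsymbol{\varphi}^T\hat{\mathbf{v}}$ by minimizing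 $\frac12\|\hat{\mathbf{v}}-\hat{\mathbf{u}}\|_2^2$ subject to the single constraint $v_h(\bar{\mathbf{x}})=u_{\mathcal{D}}(\bar{\mathbf{x}})$. With the Lagrange multiplier $\lambda$, the functional is $\mathcal{J}(\hat{\mathbf{v}},\lambda)=\frac12\|\hat{\mathbf{v}}-\hat{\mathbf{u}}\|_2^2+\lambda(v_h(\bar{\mathbf{x}})-u_{\mathcal{D}}(\bar{\mathbf{x}}))$, and its optimality conditions $\hat{\mathbf{v}}-\hat{\mathbf{u}}+\lambda\boldsymbol{\varphi}(\bar{\mathbf{x}})=0$, $\boldsymbol{\varphi}^T(\bar{\mathbf{x}})\hat{\mathbf{v}}-u_{\mathcal{D}}(\bar{\mathbf{x}})=0$ are the linear system in the claim. The method then uses $v_h(\tilde{\mathbf{x}})=\boldsymbol{\varphi}^T(\tilde{\mathbf{x}})\hat{\mathbf{v}}$ as the boundary value at $\tilde{\mathbf{x}}$. *)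

theory Defs
  imports "HOL-Analysis.Analysis" "HOL-Library.Function_Algebras"
begin

global_interpretation fun_space: vector_space "\<lambda>(c::real) (f::'a \<Rightarrow> real) x. c * f x"
  by standard (simp_all add: fun_eq_iff algebra_simps)

definition monomial_function :: "('d::finite \<Rightarrow> nat) \<Rightarrow> real^'d \<Rightarrow> real" where
  "monomial_function a x = (\<Prod>i\<in>UNIV. (x $ i) ^ a i)"

text \<open>Polynomials of total degree at most \<open>p\<close>, as functions on the whole space.\<close>
definition poly_space :: "nat \<Rightarrow> (real^'d::finite \<Rightarrow> real) set" where
  "poly_space p = fun_space.span {monomial_function a | a. (\<Sum>i\<in>UNIV. a i) \<le> p}"

definition is_basis_of :: "('k \<Rightarrow> 'a \<Rightarrow> real) \<Rightarrow> ('a \<Rightarrow> real) set \<Rightarrow> bool" where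
  "is_basis_of \<psi> V \<longleftrightarrow>
     inj \<psi> \<and> fun_space.independent (range \<psi>) \<and> fun_space.span (range \<psi>) = V"

definition simplicial_mesh :: "(real^'d::finite) set set \<Rightarrow> bool" where
  "simplicial_mesh \<T> \<longleftrightarrow>
     finite \<T> \<and> (\<forall>T\<in>\<T>. int CARD('d) simplex T) \<and>
     pairwise (\<lambda>S T. interior S \<inter> interior T = {}) \<T>"

definition boundary_element :: "(real^'d::finite) set set \<Rightarrow> (real^'d) set \<Rightarrow> bool" where
  "boundary_element \<T> T \<longleftrightarrow>
     T \<in> \<T> \<and> (\<exists>F. F facet_of T \<and> F \<subseteq> frontier (\<Union>\<T>))"

definition block_vector :: "real^'m \<Rightarrow> real^'n \<Rightarrow> real^('m::finite + 'n::finite)" where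
  "block_vector v w = (\<chi> i. case i of Inl a \<Rightarrow> v $ a | Inr b \<Rightarrow> w $ b)"

definition block_matrix ::
  "real^'c^'r \<Rightarrow> real^'e^'r \<Rightarrow> real^'c^'s \<Rightarrow> real^'e^'s
    \<Rightarrow> real^('c::finite + 'e::finite)^('r::finite + 's::finite)" where
  "block_matrix A B C D =
     (\<chi> i. case i of Inl r \<Rightarrow> block_vector (A $ r) (B $ r)
                  | Inr s \<Rightarrow> block_vector (C $ s) (D $ s))"

end

theory Submission
  imports Defs
begin

text \<open>
  The first block row of the optimality system says that the minimizer differs from
  \<open>u_hat\<close> by a multiple of \<open>\<phi> x_bar\<close>: the correction is orthogonal to the
  constraint hyperplane. Substituting this into the constraint (the second block row) determines
  the multiple as the residual of \<open>u\<^sub>h\<close> at the constraint point divided by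
  \<open>\<phi> x_bar \<bullet> \<phi> x_bar\<close>, and pairing with the basis values at the other point
  turns this residual into the term with the factor \<open>\<alpha>\<close>
  (\<open>single_constraint_projection_inner\<close>).

  The division is legitimate because the constraint vector cannot vanish: the space of polynomials
  contains the constant \<open>1\<close>, and if all members of a spanning family vanished at a point,
  so would every polynomial (\<open>polynomial_basis_nonvanishing\<close>).
\<close>

lemma span_vanishes_at:
  fixes S :: "('a \<Rightarrow> real) set"
  assumes "f \<in> fun_space.span S" and "\<And>g. g \<in> S \<Longrightarrow> g x = 0"
  shows "f x = 0"
proof -
  have "fun_space.subspace {g :: 'a \<Rightarrow> real. g x = 0}"
    by (simp add: fun_space.subspace_def)
  with assms have "fun_space.span S \<subseteq> {g. g x = 0}"
    by (intro fun_space.span_minimal) auto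
  with assms(1) show ?thesis by blast
qed

lemma one_in_poly_space: "(\<lambda>x :: real^'d::finite. 1) \<in> poly_space p"
proof -
  have "monomial_function (\<lambda>i. 0) = (\<lambda>x :: real^'d. 1)"
    by (simp add: fun_eq_iff monomial_function_def)
  then have "(\<lambda>x :: real^'d. 1) \<in> {monomial_function a | a. (\<Sum>i\<in>UNIV. a i) \<le> p}"
    by (intro CollectI exI[of _ "\<lambda>i. 0"]) simp
  then show ?thesis
    unfolding poly_space_def by (rule fun_space.span_base)
qed

lemma polynomial_basis_nonvanishing:
  fixes \<psi> :: "'k::finite \<Rightarrow> real^'d::finite \<Rightarrow> real"
  assumes "is_basis_of \<psi> (poly_space p)"
  shows "(\<chi> k. \<psi> k x) \<noteq> 0"
proof
  assume "(\<chi> k. \<psi> k x) = 0"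
  then have "\<psi> k x = 0" for k
    by (simp add: vec_eq_iff)
  moreover have "(\<lambda>x. 1) \<in> fun_space.span (range \<psi>)"
    using assms one_in_poly_space by (simp add: is_basis_of_def)
  ultimately have "(1 :: real) = 0"
    using span_vanishes_at[of "\<lambda>x. 1" "range \<psi>" x] by blast
  then show False by simp
qed

lemma block_vector_nth [simp]:
  "block_vector v w $ Inl i = v $ i"
  "block_vector v w $ Inr j = w $ j"
  by (simp_all add: block_vector_def)

lemma block_vector_eq_iff: "block_vector v w = block_vector v' w' \<longleftrightarrow> v = v' \<and> w = w'"
  by (auto simp: vec_eq_iff split_sum_all)

lemma block_matrix_vector_mult:
  "block_matrix A B C D *v block_vector v w =
    block_vector (A *v v + B *v w) (C *v v + D *v w)"
proof -
  have split: "(\<Sum>i\<in>UNIV. f i) = (\<Sum>i\<in>UNIV. f (Inl i)) + (\<Sum>j\<in>UNIV. f (Inr j))"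
    for f :: "'m::finite + 'n::finite \<Rightarrow> real"
    by (simp add: UNIV_Plus_UNIV[symmetric] sum.Plus del: UNIV_Plus_UNIV)
  show ?thesis
    by (simp add: vec_eq_iff split_sum_all block_matrix_def matrix_vector_mult_def split)
qed

text \<open>
  Read blockwise, the bordered matrix encodes stationarity of the Lagrangian and feasibility.
\<close>
lemma saddle_point_system_iff:
  "block_matrix (mat 1) (columnvector g) (rowvector g) (0 :: real^1^1)
      *v block_vector v (vec lam) = block_vector u (vec d)
    \<longleftrightarrow> v + lam *\<^sub>R g = u \<and> g \<bullet> v = d"
proof -
  have "columnvector g *v (vec lam :: real^1) = lam *\<^sub>R g"
    by (simp add: vec_eq_iff columnvector_def matrix_vector_mult_def)
  moreover have "rowvector g *v v = (vec (g \<bullet> v) :: real^1)"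
    by (simp add: vec_eq_iff rowvector_def matrix_vector_mult_def inner_vec_def)
  ultimately show ?thesis
    by (simp add: block_matrix_vector_mult block_vector_eq_iff)
qed

text \<open>
  Here \<open>v\<close> is the orthogonal projection of \<open>u\<close> onto the hyperplane
  \<open>g \<bullet> v = d\<close>, so that \<open>lam\<close> is the signed residual
  \<open>g \<bullet> u - d\<close> in units of \<open>g \<bullet> g\<close>.
\<close>
lemma single_constraint_projection_inner:
  fixes f g u v :: "'a::real_inner"
  assumes stationary: "v + lam *\<^sub>R g = u" and feasible: "g \<bullet> v = d" and "g \<noteq> 0"
  defines "\<alpha> \<equiv> (f \<bullet> g) / (g \<bullet> g)"
  shows "f \<bullet> v = (f - \<alpha> *\<^sub>R g) \<bullet> u + \<alpha> * d"
proof -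
  have v: "v = u - lam *\<^sub>R g"
    using stationary by (simp add: algebra_simps)
  have residual: "lam * (g \<bullet> g) = g \<bullet> u - d"
    using feasible by (simp add: v inner_diff_right)
  have "f \<bullet> g = \<alpha> * (g \<bullet> g)"
    using \<open>g \<noteq> 0\<close> by (simp add: \<alpha>_def)
  then have "lam * (f \<bullet> g) = \<alpha> * (g \<bullet> u - d)"
    by (simp add: residual[symmetric])
  then show ?thesis
    by (simp add: v inner_diff_right inner_diff_left algebra_simps)
qed

theorem proposition2:
  fixes \<Omega> \<Omega>\<^sub>h T :: "(real^'d::finite) set"
    and \<T> :: "(real^'d) set set"
    and M :: "real^'d \<Rightarrow> real^'d"
    and p :: nat
    and \<psi> :: "'k::finite \<Rightarrow> real^'d \<Rightarrow> real"
    and \<phi> :: "real^'d \<Rightarrow> real^'k"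
    and u\<^sub>h v\<^sub>h u\<^sub>D :: "real^'d \<Rightarrow> real"
    and u_hat v_hat :: "real^'k"
    and lam \<alpha> :: real
    and x_tilde x_bar :: "real^'d"
  assumes domain: "open \<Omega>" "connected \<Omega>" "\<Omega> \<noteq> {}"
    and mesh: "simplicial_mesh \<T>" "\<Omega>\<^sub>h = \<Union>\<T>"
    and element: "boundary_element \<T> T"
    and mapping: "M \<in> frontier \<Omega>\<^sub>h \<rightarrow> frontier \<Omega>"
    and card_basis: "real CARD('k) = (\<Prod>l = 1..CARD('d). (real p + real l) / real l)"
    and basis: "is_basis_of \<psi> (poly_space p)"
    and phi: "\<phi> = (\<lambda>x. \<chi> k. \<psi> k x)"
    and u_h: "u\<^sub>h = (\<lambda>x. \<phi> x \<bullet> u_hat)"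
    and x_tilde: "x_tilde \<in> frontier \<Omega>\<^sub>h"
    and x_bar: "x_bar = M x_tilde"
    and rod_e_system:
      "block_matrix (mat 1) (columnvector (\<phi> x_bar)) (rowvector (\<phi> x_bar)) (0 :: real^1^1)
         *v block_vector v_hat (vec lam)
       = block_vector u_hat (vec (u\<^sub>D x_bar))"
    and v_h: "v\<^sub>h = (\<lambda>x. \<phi> x \<bullet> v_hat)"
    and alpha: "\<alpha> = (\<phi> x_tilde \<bullet> \<phi> x_bar) / (\<phi> x_bar \<bullet> \<phi> x_bar)"
  shows "\<phi> x_bar \<bullet> \<phi> x_bar \<noteq> 0
    \<and> v\<^sub>h x_tilde = (\<phi> x_tilde - \<alpha> *\<^sub>R \<phi> x_bar) \<bullet> u_hat + \<alpha> * u\<^sub>D x_bar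
    \<and> \<alpha> = (\<phi> x_tilde \<bullet> \<phi> x_bar) / (norm (\<phi> x_bar))\<^sup>2"
proof -
  have nonzero: "\<phi> x_bar \<noteq> 0"
    using polynomial_basis_nonvanishing[OF basis] by (simp add: phi)
  have "v_hat + lam *\<^sub>R \<phi> x_bar = u_hat" and "\<phi> x_bar \<bullet> v_hat = u\<^sub>D x_bar"
    using rod_e_system by (simp_all add: saddle_point_system_iff)
  then have "v\<^sub>h x_tilde = (\<phi> x_tilde - \<alpha> *\<^sub>R \<phi> x_bar) \<bullet> u_hat + \<alpha> * u\<^sub>D x_bar"
    using nonzero unfolding v_h alpha by (rule single_constraint_projection_inner)
  with nonzero show ?thesis
    by (simp add: alpha power2_norm_eq_inner)
qed

end
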